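(* Let $\Bbbk$ be an algebraically closed field, and let $f = \sum_{i=1}^K c_i \mathbf{x}^{\mathbf{a}_i} \in \Bbbk[x_1,\ldots,x_n]$ be a disjointly supported polynomial with no constant term, where all $c_i \in \Bbbk$ are nonzero and the exponent vectors $\mathbf{a}_i \in \mathbb{Z}_{\geq 0}^n\setminus\{0\}$ are pairwise distinct. Let $S \subseteq [K] = \{1,\ldots,K\}$, let $f_S = \sum_{j \in S} c_j \mathbf{x}^{\mathbf{a}_j}$, and let $C_S := \{\boldsymbol\omega \in \mathbb{R}^n \mid in_{\boldsymbol\omega}(f) = f_S\}$. Then \[ C_S = L_f + \sum_{i \notin S} \mathbb{R}_{>0}\,\mathbf{w}_i , \] where the sum is over $i \in [K]\setminus S$, the right-hand side is a Minkowski sum, and $L_f$ and $\mathbf{w}_i$ are the homogeneity space of $f$ and the vectors defined in the context.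
   Context: For $\mathbf{a} = (a_1,\ldots,a_n) \in \mathbb{Z}_{\geq 0}^n$ write $\mathbf{x}^{\mathbf{a}} = x_1^{a_1}\cdots x_n^{a_n}$ and $supp(\mathbf{a}) = \{j : a_j \neq 0\}$. The polynomial $f$ is disjointly supported if $supp(\mathbf{a}_i)\cap supp(\mathbf{a}_j) = \varnothing$ for all $i \neq j$. For $\boldsymbol\omega \in \mathbb{R}^n$, the initial form $in_{\boldsymbol\omega}(f)$ is the sum of those terms $c_i\mathbf{x}^{\mathbf{a}_i}$ of $f$ for which the inner product $\langle \boldsymbol\omega, \mathbf{a}_i\rangle$ is maximal among all terms of $f$. The homogeneity space of $f$ is the linear subspace $L_f = \{\mathbf{u} \in \mathbb{R}^n \mid \langle \mathbf{u}, \mathbf{a}_i\rangle = \langle \mathbf{u}, \mathbf{a}_j\rangle \text{ for all } 1 \leq i < j \leq K\}$. For each $i \in [K]$, $\mathbf{w}_i \in \mathbb{R}^n$ is the vector with entry $-1$ at each index $j \in supp(\mathbf{a}_i)$ and entry $0$ at each index $j \notin supp(\mathbf{a}_i)$. An empty Minkowski sum is $\{0\}$.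
   Formalization: The formal statement assumes S is nonempty unless K = 0: for S empty and K ≥ 1 the claim always fails, since no initial form of f is 0, so C_S is empty while the right-hand side is not (e.g. f = x). *)

theory Defs
  imports
    "HOL-Analysis.Analysis"
    "HOL-Library.Poly_Mapping"
    "HOL-Library.Set_Algebras"
begin

text \<open>
  The polynomial ring in finitely many variables, indexed by a finite type \<open>'n\<close>, over \<open>'k\<close> is
  the monoid algebra \<open>('n \<Rightarrow>\<^sub>0 nat) \<Rightarrow>\<^sub>0 'k\<close> with its convolution product. The term with coefficient
  \<open>c\<close> and exponent vector \<open>a\<close> is \<open>Poly_Mapping.single a c\<close>; the support of an exponent vector \<open>a\<close>
  is \<open>Poly_Mapping.keys a\<close>, and the exponent vectors occurring in \<open>f\<close> with nonzero
  coefficient are \<open>Poly_Mapping.keys f\<close>.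
\<close>

type_synonym ('n, 'k) mv_poly = "('n \<Rightarrow>\<^sub>0 nat) \<Rightarrow>\<^sub>0 'k"

definition exponent_vec :: "('n::finite \<Rightarrow>\<^sub>0 nat) \<Rightarrow> real ^ 'n" where
  "exponent_vec a = (\<chi> j. real (Poly_Mapping.lookup a j))"

definition disjointly_supported :: "('n, 'k::zero) mv_poly \<Rightarrow> bool" where
  "disjointly_supported f \<longleftrightarrow>
     (\<forall>a\<in>Poly_Mapping.keys f. \<forall>b\<in>Poly_Mapping.keys f. a \<noteq> b \<longrightarrow>
        Poly_Mapping.keys a \<inter> Poly_Mapping.keys b = {})"

definition initial_form ::
    "real ^ 'n \<Rightarrow> ('n::finite, 'k::comm_monoid_add) mv_poly \<Rightarrow> ('n, 'k) mv_poly" where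
  "initial_form \<omega> f =
     (\<Sum>a\<in>{a\<in>Poly_Mapping.keys f. \<forall>b\<in>Poly_Mapping.keys f.
             \<omega> \<bullet> exponent_vec b \<le> \<omega> \<bullet> exponent_vec a}.
        Poly_Mapping.single a (Poly_Mapping.lookup f a))"

definition homogeneity_space :: "('n::finite, 'k::zero) mv_poly \<Rightarrow> (real ^ 'n) set" where
  "homogeneity_space f =
     {u. \<forall>a\<in>Poly_Mapping.keys f. \<forall>b\<in>Poly_Mapping.keys f.
           u \<bullet> exponent_vec a = u \<bullet> exponent_vec b}"

definition neg_supp_vec :: "('n::finite \<Rightarrow>\<^sub>0 nat) \<Rightarrow> real ^ 'n" where
  "neg_supp_vec a = (\<chi> j. if j \<in> Poly_Mapping.keys a then - 1 else 0)"

definition open_ray :: "'v::real_vector \<Rightarrow> 'v set" where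
  "open_ray w = {r *\<^sub>R w | r. r > 0}"

end

theory Submission
  imports Defs
begin

text \<open>
  Since the supports are disjoint, the vectors \<open>w\<^sub>i\<close> are dual to the exponent vectors up to scaling:
  \<open>\<langle>w\<^sub>i, a\<^sub>j\<rangle> = 0\<close> for \<open>i \<noteq> j\<close>, and \<open>\<langle>w\<^sub>i, a\<^sub>i\<rangle> < 0\<close>. Adding \<open>\<Sum> r\<^sub>i w\<^sub>i\<close> over \<open>i \<notin> S\<close> with positive \<open>r\<^sub>i\<close>
  to a weight in \<open>L\<^sub>f\<close> therefore lowers exactly the terms outside \<open>S\<close> below the common value, and
  conversely every weight \<open>\<omega>\<close> with maximum \<open>h\<close> on exactly \<open>S\<close> is brought back to \<open>L\<^sub>f\<close> by
  \<open>r\<^sub>i = (\<langle>\<omega>, a\<^sub>i\<rangle> - h) / \<langle>w\<^sub>i, a\<^sub>i\<rangle>\<close>.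
\<close>

lemma lookup_sum_single:
  assumes "finite T"
  shows "Poly_Mapping.lookup (\<Sum>a\<in>T. Poly_Mapping.single a (g a)) b = (if b \<in> T then g b else 0)"
  using assms by (simp add: lookup_sum lookup_single when_def)

lemma keys_sum_single:
  assumes "finite T" and "\<And>a. a \<in> T \<Longrightarrow> g a \<noteq> 0"
  shows "Poly_Mapping.keys (\<Sum>a\<in>T. Poly_Mapping.single a (g a)) = T"
  using assms by (auto simp: in_keys_iff lookup_sum_single split: if_splits)

text \<open>All coefficients of \<open>f\<close> on its keys are nonzero, so a partial sum of its
  terms is determined by its set of exponents. An equation of polynomials thus becomes an equation
  of finite sets.\<close>

lemma initial_form_eq_iff:
  assumes "T \<subseteq> Poly_Mapping.keys f"
  shows "initial_form \<omega> f = (\<Sum>a\<in>T. Poly_Mapping.single a (Poly_Mapping.lookup f a)) \<longleftrightarrow>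
    {a \<in> Poly_Mapping.keys f. \<forall>b\<in>Poly_Mapping.keys f.
       \<omega> \<bullet> exponent_vec b \<le> \<omega> \<bullet> exponent_vec a} = T"
    (is "_ \<longleftrightarrow> ?M = T")
proof
  have restrict: "Poly_Mapping.keys (\<Sum>a\<in>U. Poly_Mapping.single a (Poly_Mapping.lookup f a)) = U"
    if "U \<subseteq> Poly_Mapping.keys f" for U
    using that by (intro keys_sum_single) (auto simp: in_keys_iff intro: finite_subset)
  assume "initial_form \<omega> f = (\<Sum>a\<in>T. Poly_Mapping.single a (Poly_Mapping.lookup f a))"
  then have "Poly_Mapping.keys (initial_form \<omega> f) = T"
    by (simp only: restrict[OF assms])
  then show "?M = T"
    by (simp only: initial_form_def restrict[OF Collect_restrict])
qed (simp add: initial_form_def)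

lemma neg_supp_vec_inner_exponent_vec:
  "neg_supp_vec a \<bullet> exponent_vec b = - (\<Sum>j\<in>Poly_Mapping.keys a. real (Poly_Mapping.lookup b j))"
  by (simp add: neg_supp_vec_def exponent_vec_def inner_vec_def if_distrib[of "\<lambda>x. x * _"]
      sum.If_cases sum_negf)

lemma neg_supp_vec_inner_disjoint:
  assumes "Poly_Mapping.keys a \<inter> Poly_Mapping.keys b = {}"
  shows "neg_supp_vec a \<bullet> exponent_vec b = 0"
  using assms unfolding neg_supp_vec_inner_exponent_vec
  by (auto simp: in_keys_iff intro!: sum.neutral)

lemma neg_supp_vec_inner_self:
  assumes "a \<noteq> 0"
  shows "neg_supp_vec a \<bullet> exponent_vec a < 0"
  using assms unfolding neg_supp_vec_inner_exponent_vec
  by (auto simp: in_keys_iff intro!: sum_pos)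

text \<open>Duality in usable form: the coefficients \<open>r a\<close> shift the values of a weight
  at the exponents in \<open>T\<close> independently of each other.\<close>

lemma sum_neg_supp_vec_inner:
  assumes "disjointly_supported f" and "T \<subseteq> Poly_Mapping.keys f" and b: "b \<in> Poly_Mapping.keys f"
  shows "(\<Sum>a\<in>T. r a *\<^sub>R neg_supp_vec a) \<bullet> exponent_vec b =
    (if b \<in> T then r b * (neg_supp_vec b \<bullet> exponent_vec b) else 0)"
proof -
  have "finite T"
    using assms(2) by (rule finite_subset) simp
  have "neg_supp_vec a \<bullet> exponent_vec b = 0" if "a \<in> T" "a \<noteq> b" for a
    using assms that by (intro neg_supp_vec_inner_disjoint) (auto simp: disjointly_supported_def)
  then have "(\<Sum>a\<in>T. r a *\<^sub>R neg_supp_vec a) \<bullet> exponent_vec b =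
    (\<Sum>a\<in>T. if a = b then r b * (neg_supp_vec b \<bullet> exponent_vec b) else 0)"
    by (auto simp: inner_sum_left intro!: sum.cong)
  also have "\<dots> = (if b \<in> T then r b * (neg_supp_vec b \<bullet> exponent_vec b) else 0)"
    using \<open>finite T\<close> by simp
  finally show ?thesis .
qed

text \<open>Choosing one scalar per summand turns a Minkowski sum of rays into a set described by a
  single coefficient function.\<close>

lemma sum_open_ray:
  assumes "finite I"
  shows "(\<Sum>i\<in>I. open_ray (w i)) = {\<Sum>i\<in>I. r i *\<^sub>R w i | r. \<forall>i\<in>I. r i > 0}"
proof -
  have "\<exists>r. (\<Sum>i\<in>I. s i) = (\<Sum>i\<in>I. r i *\<^sub>R w i) \<and> (\<forall>i\<in>I. r i > 0)"
    if "\<forall>i\<in>I. s i \<in> open_ray (w i)" for s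
  proof -
    have "\<forall>i\<in>I. \<exists>r. s i = r *\<^sub>R w i \<and> r > 0"
      using that by (auto simp: open_ray_def)
    from bchoice[OF this] obtain r where "\<forall>i\<in>I. s i = r i *\<^sub>R w i \<and> r i > 0"
      by blast
    then show ?thesis
      by (intro exI[of _ r]) (auto intro: sum.cong)
  qed
  moreover have "\<exists>s. (\<Sum>i\<in>I. r i *\<^sub>R w i) = (\<Sum>i\<in>I. s i) \<and> (\<forall>i\<in>I. s i \<in> open_ray (w i))"
    if "\<forall>i\<in>I. r i > 0" for r
    using that by (intro exI[of _ "\<lambda>i. r i *\<^sub>R w i"]) (auto simp: open_ray_def)
  ultimately show ?thesis
    unfolding set_sum_alt[OF assms] by blast
qed

text \<open>Indexing by the exponents themselves lets the coefficients be read off from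
  \<open>f\<close>, so the geometry is separated from the numbering of the terms.\<close>

lemma initial_form_cone:
  fixes f :: "('n::finite, 'k::comm_monoid_add) mv_poly"
  assumes disj: "disjointly_supported f" and no_const: "0 \<notin> Poly_Mapping.keys f"
    and T: "T \<subseteq> Poly_Mapping.keys f" and T_nonempty: "T \<noteq> {} \<or> Poly_Mapping.keys f = {}"
  shows "{\<omega>. initial_form \<omega> f = (\<Sum>a\<in>T. Poly_Mapping.single a (Poly_Mapping.lookup f a))} =
    homogeneity_space f + (\<Sum>a\<in>Poly_Mapping.keys f - T. open_ray (neg_supp_vec a))"
    (is "?C = ?R")
proof (intro subset_antisym subsetI)
  let ?A = "Poly_Mapping.keys f"
  have neg: "neg_supp_vec a \<bullet> exponent_vec a < 0" if "a \<in> ?A" for a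
    using no_const that by (intro neg_supp_vec_inner_self) auto
  note inner = sum_neg_supp_vec_inner[OF disj Diff_subset]
  {
    fix \<omega> assume "\<omega> \<in> ?C"
    then have M: "{a \<in> ?A. \<forall>b\<in>?A. \<omega> \<bullet> exponent_vec b \<le> \<omega> \<bullet> exponent_vec a} = T"
      by (simp add: initial_form_eq_iff[OF T])
    obtain h where h: "\<And>a. a \<in> T \<Longrightarrow> \<omega> \<bullet> exponent_vec a = h"
      and h_less: "\<And>a. a \<in> ?A - T \<Longrightarrow> \<omega> \<bullet> exponent_vec a < h"
    proof (cases "T = {}")
      case True
      \<comment> \<open>Here \<open>f\<close> has no terms, so both conditions on \<open>h\<close>
        are vacuous and 0 is an arbitrary choice.\<close>
      then show thesis
        using T_nonempty by (intro that[of 0]) auto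
    next
      case False
      then obtain t where t: "t \<in> T"
        by blast
      show thesis
      proof (rule that[of "\<omega> \<bullet> exponent_vec t"])
        show "\<omega> \<bullet> exponent_vec a = \<omega> \<bullet> exponent_vec t" if "a \<in> T" for a
          using that t M by (auto intro: antisym)
        show "\<omega> \<bullet> exponent_vec a < \<omega> \<bullet> exponent_vec t" if a: "a \<in> ?A - T" for a
        proof -
          \<comment> \<open>As \<open>a\<close> is not a maximizer, some \<open>b\<close> beats it,
            and the maximizer \<open>t\<close> is at least as good as \<open>b\<close>.\<close>
          obtain b where "b \<in> ?A" "\<omega> \<bullet> exponent_vec a < \<omega> \<bullet> exponent_vec b"
            using a M by force
          moreover have "\<omega> \<bullet> exponent_vec b \<le> \<omega> \<bullet> exponent_vec t"
            using t M \<open>b \<in> ?A\<close> by blast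
          ultimately show ?thesis
            by simp
        qed
      qed
    qed
    define r where "r a = (\<omega> \<bullet> exponent_vec a - h) / (neg_supp_vec a \<bullet> exponent_vec a)" for a
    define v where "v = (\<Sum>a\<in>?A - T. r a *\<^sub>R neg_supp_vec a)"
    have "r a > 0" if "a \<in> ?A - T" for a
      using h_less[OF that] neg[of a] that by (simp add: r_def divide_neg_neg)
    then have "v \<in> (\<Sum>a\<in>?A - T. open_ray (neg_supp_vec a))"
      by (auto simp: sum_open_ray v_def)
    moreover have "(\<omega> - v) \<bullet> exponent_vec b = h" if "b \<in> ?A" for b
      using that h[of b] neg[of b] by (auto simp: v_def inner_diff_left inner r_def)
    then have "\<omega> - v \<in> homogeneity_space f"
      by (simp add: homogeneity_space_def)
    ultimately show "\<omega> \<in> ?R"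
      by (metis diff_add_cancel set_plus_intro)
  }
  {
    fix \<omega> assume "\<omega> \<in> ?R"
    then obtain u r where u: "u \<in> homogeneity_space f" and r: "\<forall>a\<in>?A - T. r a > 0"
      and \<omega>: "\<omega> = u + (\<Sum>a\<in>?A - T. r a *\<^sub>R neg_supp_vec a)"
      by (auto simp: sum_open_ray elim!: set_plus_elim)
    obtain h where h: "\<And>b. b \<in> ?A \<Longrightarrow> u \<bullet> exponent_vec b = h"
      using u unfolding homogeneity_space_def by blast
    have eq: "\<omega> \<bullet> exponent_vec b = h" if "b \<in> T" for b
      using that T h[of b] by (auto simp: \<omega> inner_add_left inner)
    have less: "\<omega> \<bullet> exponent_vec b < h" if "b \<in> ?A - T" for b
      using that h[of b] r neg[of b] by (auto simp: \<omega> inner_add_left inner mult_pos_neg)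
    have le: "\<omega> \<bullet> exponent_vec b \<le> h" if "b \<in> ?A" for b
      using that eq[of b] less[of b] by (cases "b \<in> T") auto
    have "{a \<in> ?A. \<forall>b\<in>?A. \<omega> \<bullet> exponent_vec b \<le> \<omega> \<bullet> exponent_vec a} = T"
    proof (intro subset_antisym subsetI)
      fix a assume a: "a \<in> {a \<in> ?A. \<forall>b\<in>?A. \<omega> \<bullet> exponent_vec b \<le> \<omega> \<bullet> exponent_vec a}"
      \<comment> \<open>The exponent \<open>a\<close> shows that \<open>f\<close> has terms, so
        \<open>T\<close> is nonempty. The maximum is therefore at least \<open>h\<close>, which
        exponents outside \<open>T\<close> do not reach.\<close>
      then obtain t where "t \<in> T"
        using T_nonempty by blast
      then have "h \<le> \<omega> \<bullet> exponent_vec a"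
        using a T eq[of t] by force
      then show "a \<in> T"
        using a less[of a] by force
    qed (use T eq le in auto)
    then show "\<omega> \<in> ?C"
      by (simp add: initial_form_eq_iff[OF T])
  }
qed

text \<open>\<open>S_nonempty\<close> excludes a false case: for \<open>K > 0\<close> and empty
  \<open>S\<close> the left side is empty, since a maximum is attained, while the right side is not.
  For \<open>K = 0\<close> both sides are the whole space.\<close>

theorem proposition1:
  fixes f :: "('n::finite, 'k::alg_closed_field) mv_poly"
    and K :: nat
    and c :: "nat \<Rightarrow> 'k"
    and a :: "nat \<Rightarrow> ('n \<Rightarrow>\<^sub>0 nat)"
    and S :: "nat set"
  assumes f_eq: "f = (\<Sum>i\<in>{1..K}. Poly_Mapping.single (a i) (c i))"
    and c_nonzero: "\<forall>i\<in>{1..K}. c i \<noteq> 0"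
    and a_nonzero: "\<forall>i\<in>{1..K}. a i \<noteq> 0"
    and a_distinct: "inj_on a {1..K}"
    and no_const: "Poly_Mapping.lookup f 0 = 0"
    and disj_supp: "disjointly_supported f"
    and S_subset: "S \<subseteq> {1..K}"
    and S_nonempty: "S \<noteq> {} \<or> K = 0"
  shows "{\<omega>. initial_form \<omega> f = (\<Sum>j\<in>S. Poly_Mapping.single (a j) (c j))} =
         homogeneity_space f + (\<Sum>i\<in>{1..K} - S. open_ray (neg_supp_vec (a i)))"
proof -
  \<comment> \<open>Injectivity of \<open>a\<close> lets the coefficients be carried from indices to
    exponents.\<close>
  define g where "g = c \<circ> inv_into {1..K} a"
  have g: "g (a i) = c i" if "i \<in> {1..K}" for i
    using that a_distinct by (simp add: g_def)
  have reindex: "(\<Sum>i\<in>I. Poly_Mapping.single (a i) (c i)) = (\<Sum>b\<in>a ` I. Poly_Mapping.single b (g b))"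
    if "I \<subseteq> {1..K}" for I
    using that g by (auto simp: sum.reindex[OF inj_on_subset[OF a_distinct that]] intro!: sum.cong)
  have f: "f = (\<Sum>b\<in>a ` {1..K}. Poly_Mapping.single b (g b))"
    unfolding f_eq by (rule reindex) simp
  have keys: "Poly_Mapping.keys f = a ` {1..K}"
    unfolding f using c_nonzero g by (intro keys_sum_single) auto
  have lookup: "Poly_Mapping.lookup f b = g b" if "b \<in> a ` {1..K}" for b
    using that unfolding f by (subst lookup_sum_single) auto
  have f_S: "(\<Sum>j\<in>S. Poly_Mapping.single (a j) (c j)) =
    (\<Sum>b\<in>a ` S. Poly_Mapping.single b (Poly_Mapping.lookup f b))"
    unfolding reindex[OF S_subset] using S_subset by (intro sum.cong refl) (subst lookup; auto)
  \<comment> \<open>By injectivity the image of the complement of \<open>S\<close> is the complement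
    of the image, and each ray is counted once.\<close>
  have rays: "(\<Sum>i\<in>{1..K} - S. open_ray (neg_supp_vec (a i))) =
    (\<Sum>b\<in>Poly_Mapping.keys f - a ` S. open_ray (neg_supp_vec b))"
    unfolding keys inj_on_image_set_diff[OF a_distinct Diff_subset S_subset, symmetric]
    by (simp only: sum.reindex[OF inj_on_subset[OF a_distinct Diff_subset]] o_def)
  show ?thesis
    unfolding f_S rays
  proof (rule initial_form_cone)
    show "0 \<notin> Poly_Mapping.keys f"
      using no_const by (simp add: in_keys_iff)
    show "a ` S \<subseteq> Poly_Mapping.keys f" "a ` S \<noteq> {} \<or> Poly_Mapping.keys f = {}"
      using S_subset S_nonempty by (auto simp: keys)
  qed (fact disj_supp)
qed

end
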